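(* Let $n_1\in\mathbb C\setminus\{0\}$, $n_2\in\mathbb C$ and $\alpha_1,\alpha_2\in\mathbb C$. Suppose that a system of the form $(S)$ (see context), with coefficients $a_1,\dots,a_{10}\in\mathbb C(t)$, has the following Painlevé scheme for some $f_0,f_1\in\mathbb C(t)$: (i) $X=0$ is an accessible singular point of multiplicity $3$, and in the coordinates $(X',Y')=(x,x^3y)$ the point $(X',Y')=(0,-\tfrac12)$ is an accessible singular point with matrix of linear approximation $f_0\begin{pmatrix}1&0\\ 2t&n_2\end{pmatrix}$; (ii) $X=\infty$ is an accessible singular point with matrix of linear approximation $f_1\begin{pmatrix}n_1&\alpha_1\\ 0&1\end{pmatrix}$. Then the system coincides, for some $a(t)\in\mathbb C(t)$, with $$\begin{aligned}\frac{dx}{dt}=&\,a(t)\Big(x^3y+\frac{(n_1\alpha_2-\alpha_1)x^2}{n_1}+\frac{(2n_1-1)tx}{3n_1}+\frac{n_1+1}{6n_1}\Big),\\ \frac{dy}{dt}=&\,a(t)\Big(-\frac{(2n_1-1)x^2y^2}{n_1}+\frac{2\alpha_1-(3n_1-2)\alpha_2}{n_1}xy-\frac{(2n_1-1)ty}{3n_1}+\frac{\alpha_2(\alpha_1-(n_1-1)\alpha_2)}{n_1}\Big).\end{aligned}$$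
   Context: System $(S)$: for a constant $\alpha_2\in\mathbb C$ and $a_i=a_i(t)\in\mathbb C(t)$, $$\frac{dx}{dt}=a_1x^3y+a_2x^2y+a_5xy+a_7y+\tfrac12\big((3a_1+2a_3)\alpha_2-a_4\big)x^2+\big((a_2+a_9)\alpha_2-a_6\big)x+a_8,$$ $$\frac{dy}{dt}=a_3x^2y^2+a_9xy^2+a_{10}y^2+a_4xy+a_6y+\tfrac12(a_1\alpha_2+a_4)\alpha_2 .$$ It is also polynomial in the coordinates $(x_1,y_1)=(1/x,\,-(xy+\alpha_2)x)$. Point $X=\infty$: use local coordinates $(X,Y)=(x_1,1/y_1)$. In them the system has the form $\frac{dX}{dt}=\frac{G(X,Y)}{Y}$, $\frac{dY}{dt}=H(X,Y)$ with $G,H\in\mathbb C(t)[X,Y]$. The point $(0,0)$ is an accessible singular point if $G(0,0)=0$, and its matrix of linear approximation is $M=\begin{pmatrix}M_{11}&M_{12}\\ 0&M_{22}\end{pmatrix}$ with $\frac{d}{dt}\binom XY=\frac1Y\{ M\binom XY+(\text{terms of order}\ge2)\}$, i.e. $G=M_{11}X+M_{12}Y+O(2)$, $H(0,0)=M_{22}$. Point $X=0$ of multiplicity $3$ (a triple point resolved by three blow-ups): for system $(S)$ this is the condition that the coefficient of $y$ in $dx/dt$ is divisible by $x^3$ and the coefficient of $y^2$ in $dy/dt$ is divisible by $x^2$, i.e. $a_2=a_5=a_7=a_9=a_{10}=0$. Then in $(X',Y')=(x,x^3y)$, with $W=Y'+\frac12$, the system has the form $\frac{dX'}{dt}=A(X',W)$,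 $\frac{dW}{dt}=\frac{B(X',W)}{X'}$ with $A,B\in\mathbb C(t)[X',W]$; $(X',W)=(0,0)$ is an accessible singular point if $B(0,0)=0$, and its matrix of linear approximation is $M=\begin{pmatrix}M_{11}&0\\ M_{21}&M_{22}\end{pmatrix}$ with $A(0,0)=M_{11}$ and $B=M_{21}X'+M_{22}W+(\text{terms of order}\ge2)$. *)

theory Defs
  imports Complex_Main "HOL-Computational_Algebra.Computational_Algebra"
begin

type_synonym ratfun = "complex poly fract"   (* C(t) *)
type_synonym bipoly = "ratfun poly poly"     (* C(t)[u,v], outer variable v *)
type_synonym birat  = "bipoly fract"         (* C(t)(u,v) *)

definition tvar :: ratfun where
  "tvar = to_fract [:0, 1:]"

definition const :: "complex \<Rightarrow> ratfun" where
  "const c = to_fract [:c:]"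

definition bconst :: "ratfun \<Rightarrow> bipoly" where
  "bconst c = [:[:c:]:]"

definition uvar :: bipoly where
  "uvar = [:[:0, 1:]:]"

definition vvar :: bipoly where
  "vvar = [:0, 1:]"

text \<open>The coefficient of \<open>u ^ i * v ^ j\<close>.\<close>

definition bcoeff :: "bipoly \<Rightarrow> nat \<Rightarrow> nat \<Rightarrow> ratfun" where
  "bcoeff p i j = coeff (coeff p j) i"

definition rconst :: "ratfun \<Rightarrow> birat" where
  "rconst c = to_fract (bconst c)"

definition subst2 :: "bipoly \<Rightarrow> birat \<Rightarrow> birat \<Rightarrow> birat" where
  "subst2 p X Y = poly (map_poly (\<lambda>q. poly (map_poly rconst q) X) p) Y"

text \<open>
  The extension of a derivation of an integral domain to its field of fractions by the
  quotient rule. The description is independent of the chosen fraction: see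
  \<open>fract_deriv_Fract\<close>.
\<close>

definition fract_deriv :: "('a::idom \<Rightarrow> 'a) \<Rightarrow> 'a fract \<Rightarrow> 'a fract" where
  "fract_deriv d r =
     (THE s. \<forall>p q. q \<noteq> 0 \<longrightarrow> r = Fract p q \<longrightarrow> s = Fract (d p * q - p * d q) (q * q))"

lemma fract_deriv_Fract:
  fixes d :: "'a::idom \<Rightarrow> 'a"
  assumes leibniz: "\<And>p q. d (p * q) = d p * q + p * d q" and q: "q \<noteq> 0"
  shows "fract_deriv d (Fract p q) = Fract (d p * q - p * d q) (q * q)"
  unfolding fract_deriv_def
proof (rule the_equality, intro allI impI)
  fix p' q' assume q': "q' \<noteq> 0" and "Fract p q = Fract p' q'"
  then have e: "p * q' = p' * q" using q by (simp add: eq_fract)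
  then have "d (p * q') = d (p' * q)" by simp
  then have "d p * q' + p * d q' = d p' * q + p' * d q" by (simp add: leibniz)
  with e have "(d p * q - p * d q) * (q' * q') = (d p' * q' - p' * d q') * (q * q)"
    by algebra
  then show "Fract (d p * q - p * d q) (q * q) = Fract (d p' * q' - p' * d q') (q' * q')"
    using q q' by (simp add: eq_fract)
qed (use q in blast)

definition derivation :: "('a::comm_ring \<Rightarrow> 'a) \<Rightarrow> bool" where
  "derivation d \<longleftrightarrow> (\<forall>p q. d (p + q) = d p + d q) \<and> (\<forall>p q. d (p * q) = d p * q + p * d q)"

lemma derivation_zero: "derivation d \<Longrightarrow> d 0 = 0"
  unfolding derivation_def by (metis add_cancel_right_right)

lemma derivation_one:
  fixes d :: "'a::comm_ring_1 \<Rightarrow> 'a"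
  shows "derivation d \<Longrightarrow> d 1 = 0"
  unfolding derivation_def by (metis add_cancel_right_right mult.left_neutral mult.right_neutral)

lemma derivation_sum: "derivation d \<Longrightarrow> d (sum f A) = (\<Sum>i\<in>A. d (f i))"
  by (induction A rule: infinite_finite_induct) (auto simp: derivation_zero, simp add: derivation_def)

lemma derivation_pderiv: "derivation (pderiv :: 'a::idom poly \<Rightarrow> 'a poly)"
  by (auto simp: derivation_def pderiv_add pderiv_mult algebra_simps)

lemma derivation_map_poly:
  fixes d :: "'a::comm_ring_1 \<Rightarrow> 'a"
  assumes d: "derivation d"
  shows "derivation (map_poly d)"
proof -
  note z = derivation_zero[OF d]
  show ?thesis unfolding derivation_def
  proof (intro conjI allI)
    fix p q :: "'a poly"
    show "map_poly d (p + q) = map_poly d p + map_poly d q"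
      using d by (intro poly_eqI) (simp add: coeff_map_poly z derivation_def)
    show "map_poly d (p * q) = map_poly d p * q + p * map_poly d q"
    proof (rule poly_eqI)
      fix n
      have "d (\<Sum>i\<le>n. coeff p i * coeff q (n - i))
          = (\<Sum>i\<le>n. d (coeff p i) * coeff q (n - i) + coeff p i * d (coeff q (n - i)))"
        using d by (simp add: derivation_sum[OF d] derivation_def)
      then show "coeff (map_poly d (p * q)) n = coeff (map_poly d p * q + p * map_poly d q) n"
        by (simp add: coeff_map_poly z coeff_mult sum.distrib)
    qed
  qed
qed

lemma derivation_fract_deriv:
  fixes d :: "'a::idom \<Rightarrow> 'a"
  assumes d: "derivation d"
  shows "derivation (fract_deriv d)"
proof -
  have L: "\<And>p q. d (p * q) = d p * q + p * d q" and A: "\<And>p q. d (p + q) = d p + d q"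
    using d by (auto simp: derivation_def)
  note F = fract_deriv_Fract[of d, OF L]
  show ?thesis unfolding derivation_def
  proof (intro conjI allI)
    fix r s :: "'a fract"
    obtain p q where r: "r = Fract p q" "q \<noteq> 0" by (cases r)
    obtain p' q' where s: "s = Fract p' q'" "q' \<noteq> 0" by (cases s)
    show "fract_deriv d (r + s) = fract_deriv d r + fract_deriv d s"
      using r s by (simp add: F eq_fract L A) (simp add: algebra_simps)
    show "fract_deriv d (r * s) = fract_deriv d r * s + r * fract_deriv d s"
      using r s by (simp add: F eq_fract L A) (simp add: algebra_simps)
  qed
qed

definition ddt :: "ratfun \<Rightarrow> ratfun" where
  "ddt = fract_deriv pderiv"

text \<open>
  For a system \<open>dx/dt = P(x,y)\<close>, \<open>dy/dt = Q(x,y)\<close> with coefficients in \<open>C(t)\<close>, the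
  derivative with respect to \<open>t\<close> of a polynomial, resp. rational function, in \<open>t, x, y\<close>
  along the solutions: the partial derivative in \<open>t\<close>, plus \<open>P\<close> times the partial derivative
  in \<open>x\<close>, plus \<open>Q\<close> times the partial derivative in \<open>y\<close>.
\<close>

definition poly_along :: "bipoly \<Rightarrow> bipoly \<Rightarrow> bipoly \<Rightarrow> bipoly" where
  "poly_along P Q p = map_poly (map_poly ddt) p + P * map_poly pderiv p + Q * pderiv p"

definition along :: "bipoly \<Rightarrow> bipoly \<Rightarrow> birat \<Rightarrow> birat" where
  "along P Q = fract_deriv (poly_along P Q)"

lemma derivation_ddt: "derivation ddt"
  unfolding ddt_def by (intro derivation_fract_deriv derivation_pderiv)

lemma ddt_to_fract: "ddt (to_fract p) = to_fract (pderiv p)"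
  unfolding ddt_def to_fract_def by (simp add: fract_deriv_Fract pderiv_mult algebra_simps)

lemma ddt_tvar: "ddt tvar = 1" and ddt_const: "ddt (const c) = 0"
  by (simp_all add: tvar_def const_def ddt_to_fract pderiv_pCons flip: one_pCons)

lemma derivation_poly_along: "derivation (poly_along P Q)"
  using derivation_map_poly[OF derivation_map_poly[OF derivation_ddt]]
    derivation_map_poly[OF derivation_pderiv, where 'a1 = ratfun]
    derivation_pderiv[where 'a = "ratfun poly"]
  by (simp add: derivation_def poly_along_def algebra_simps)

lemma derivation_along: "derivation (along P Q)"
  unfolding along_def by (intro derivation_fract_deriv derivation_poly_along)

lemma along_to_fract: "along P Q (to_fract p) = to_fract (poly_along P Q p)"
proof -
  have L: "poly_along P Q (p * q) = poly_along P Q p * q + p * poly_along P Q q" for p q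
    using derivation_poly_along by (auto simp: derivation_def)
  show ?thesis
    using derivation_one[OF derivation_poly_along, of P Q]
    unfolding along_def to_fract_def by (simp add: fract_deriv_Fract L)
qed

lemma along_uvar: "along P Q (to_fract uvar) = to_fract P"
  and along_vvar: "along P Q (to_fract vvar) = to_fract Q"
  and along_rconst: "along P Q (rconst c) = rconst (ddt c)"
proof -
  note d = derivation_ddt derivation_map_poly[OF derivation_ddt]
    derivation_map_poly[OF derivation_map_poly[OF derivation_ddt]]
    derivation_map_poly[OF derivation_pderiv, where 'a1 = ratfun]
  note [simp] = d[THEN derivation_zero] d[THEN derivation_one]
  show "along P Q (to_fract uvar) = to_fract P" "along P Q (to_fract vvar) = to_fract Q"
    "along P Q (rconst c) = rconst (ddt c)"
    by (simp_all add: along_to_fract poly_along_def uvar_def vvar_def rconst_def bconst_def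
        map_poly_pCons pderiv_pCons flip: one_pCons)
qed

definition S_x :: "complex \<Rightarrow> (nat \<Rightarrow> ratfun) \<Rightarrow> bipoly" where
  "S_x \<alpha>2 a = (let x = uvar; y = vvar; A = (\<lambda>i. bconst (a i)) in
     A 1 * x^3 * y + A 2 * x^2 * y + A 5 * x * y + A 7 * y
     + bconst (const (1/2) * ((3 * a 1 + 2 * a 3) * const \<alpha>2 - a 4)) * x^2
     + bconst ((a 2 + a 9) * const \<alpha>2 - a 6) * x + A 8)"

definition S_y :: "complex \<Rightarrow> (nat \<Rightarrow> ratfun) \<Rightarrow> bipoly" where
  "S_y \<alpha>2 a = (let x = uvar; y = vvar; A = (\<lambda>i. bconst (a i)) in
     A 3 * x^2 * y^2 + A 9 * x * y^2 + A 10 * y^2 + A 4 * x * y + A 6 * y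
     + bconst (const (1/2) * (a 1 * const \<alpha>2 + a 4) * const \<alpha>2))"

definition order_ge2 :: "bipoly \<Rightarrow> bool" where
  "order_ge2 p \<longleftrightarrow> (\<forall>i j. i + j < 2 \<longrightarrow> bcoeff p i j = 0)"

text \<open>The vector \<open>(F1, F2)\<close> equals \<open>(m11, m12; m21, m22) (u, v)\<close> up to terms of order at least 2.\<close>

definition linear_approx ::
    "bipoly \<Rightarrow> bipoly \<Rightarrow> ratfun \<Rightarrow> ratfun \<Rightarrow> ratfun \<Rightarrow> ratfun \<Rightarrow> bool" where
  "linear_approx F1 F2 m11 m12 m21 m22 \<longleftrightarrow>
     order_ge2 (F1 - (bconst m11 * uvar + bconst m12 * vvar)) \<and>
     order_ge2 (F2 - (bconst m21 * uvar + bconst m22 * vvar))"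

text \<open>
  The point \<open>X = \<infinity>\<close>. With \<open>(x1, y1) = (1/x, -(xy + \<alpha>2)x)\<close> and \<open>(X, Y) = (x1, 1/y1)\<close>, the
  system reads \<open>dX/dt = G(X,Y)/Y\<close>, \<open>dY/dt = H(X,Y)\<close>, that is,
  \<open>d(X,Y)/dt = (1/Y) (G, Y H)\<close>. Since \<open>X\<close> and \<open>Y\<close> are algebraically independent, \<open>G\<close> and
  \<open>H\<close> are unique.
\<close>

definition accessible_at_infinity ::
    "complex \<Rightarrow> bipoly \<Rightarrow> bipoly \<Rightarrow> ratfun \<Rightarrow> ratfun \<Rightarrow> ratfun \<Rightarrow> ratfun \<Rightarrow> bool" where
  "accessible_at_infinity \<alpha>2 P Q m11 m12 m21 m22 \<longleftrightarrow>
     (let x = to_fract uvar; y = to_fract vvar;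
          X = 1 / x; y1 = - (x * y + rconst (const \<alpha>2)) * x; Y = 1 / y1
      in \<exists>G H. along P Q X = subst2 G X Y / Y \<and>
               along P Q Y = subst2 H X Y \<and>
               bcoeff G 0 0 = 0 \<and>
               linear_approx G (vvar * H) m11 m12 m21 m22)"

text \<open>
  The triple point at \<open>X = 0\<close> is the divisibility of the coefficient of \<open>y\<close> in \<open>dx/dt\<close> by
  \<open>x ^ 3\<close> and of the coefficient of \<open>y ^ 2\<close> in \<open>dy/dt\<close> by \<open>x ^ 2\<close>.
\<close>

definition multiplicity_3_at_zero :: "bipoly \<Rightarrow> bipoly \<Rightarrow> bool" where
  "multiplicity_3_at_zero P Q \<longleftrightarrow> [:0, 1:]^3 dvd coeff P 1 \<and> [:0, 1:]^2 dvd coeff Q 2"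

text \<open>
  The point \<open>(X', Y') = (0, -1/2)\<close> for \<open>(X', Y') = (x, x^3 y)\<close>. With \<open>W = Y' + 1/2\<close> the system
  reads \<open>dX'/dt = A(X',W)\<close>, \<open>dW/dt = B(X',W)/X'\<close>, that is,
  \<open>d(X',W)/dt = (1/X') (X' A, B)\<close>.
\<close>

definition accessible_at_zero ::
    "bipoly \<Rightarrow> bipoly \<Rightarrow> ratfun \<Rightarrow> ratfun \<Rightarrow> ratfun \<Rightarrow> ratfun \<Rightarrow> bool" where
  "accessible_at_zero P Q m11 m12 m21 m22 \<longleftrightarrow>
     (let x = to_fract uvar; y = to_fract vvar;
          X' = x; Y' = x^3 * y; W = Y' + rconst (const (1/2))
      in \<exists>A B. along P Q X' = subst2 A X' W \<and>
               along P Q W = subst2 B X' W / X' \<and>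
               bcoeff B 0 0 = 0 \<and>
               linear_approx (uvar * A) B m11 m12 m21 m22)"

definition painleve_scheme ::
    "complex \<Rightarrow> complex \<Rightarrow> complex \<Rightarrow> complex \<Rightarrow> bipoly \<Rightarrow> bipoly \<Rightarrow> ratfun \<Rightarrow> ratfun \<Rightarrow> bool" where
  "painleve_scheme n1 n2 \<alpha>1 \<alpha>2 P Q f0 f1 \<longleftrightarrow>
     multiplicity_3_at_zero P Q \<and>
     accessible_at_zero P Q (f0 * 1) (f0 * 0) (f0 * (2 * tvar)) (f0 * const n2) \<and>
     accessible_at_infinity \<alpha>2 P Q (f1 * const n1) (f1 * const \<alpha>1) (f1 * 0) (f1 * 1)"

end

theory Submission
  imports Defs
begin

text \<open>
  The theorem holds because a Painleve scheme fixes local coefficients, and the local coefficients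
  determine the system. With the triple point at \<open>X = 0\<close> the coefficients \<open>a\<^sub>2, a\<^sub>5, a\<^sub>7, a\<^sub>9, a\<^sub>1\<^sub>0\<close>
  vanish. Write \<open>Z = W - 1/2 = x\<^sup>3 y\<close> near \<open>X = 0\<close>, and let \<open>c\<^sub>2\<close>, \<open>q\<^sub>0\<close> be the coefficient of
  \<open>x\<^sup>2\<close> in \<open>dx/dt\<close> and the constant term of \<open>dy/dt\<close>. Then the local forms of the system are

  \<^item> \<open>A = a\<^sub>1 Z + c\<^sub>2 X\<^sup>2 - a\<^sub>6 X + a\<^sub>8\<close> and
    \<open>B = 3 Z A + a\<^sub>3 Z\<^sup>2 + a\<^sub>4 Z X\<^sup>2 + a\<^sub>6 Z X + q\<^sub>0 X\<^sup>4\<close> at \<open>X = 0\<close>;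
  \<^item> \<open>G = a\<^sub>1 X + (a\<^sub>1 \<alpha>\<^sub>2 - c\<^sub>2) Y + a\<^sub>6 X Y - a\<^sub>8 X\<^sup>2 Y\<close> and
    \<open>H = 2 a\<^sub>1 + a\<^sub>3 + a\<^sub>6 Y - 2 a\<^sub>8 X Y - a\<^sub>8 \<alpha>\<^sub>2 Y\<^sup>2\<close> at \<open>X = \<infinity>\<close>.

  Comparing with the prescribed matrices gives, at infinity,
  \<open>a\<^sub>1 = n\<^sub>1 f\<^sub>1\<close>, \<open>2 a\<^sub>1 + a\<^sub>3 = f\<^sub>1\<close>, \<open>a\<^sub>1 \<alpha>\<^sub>2 - c\<^sub>2 = \<alpha>\<^sub>1 f\<^sub>1\<close>, and, at zero,
  \<open>3 a\<^sub>1 + a\<^sub>3 = 6 a\<^sub>8\<close> (this is \<open>B(0,0) = 0\<close>), \<open>a\<^sub>8 - a\<^sub>1 / 2 = f\<^sub>0\<close>, \<open>a\<^sub>6 = 2 t f\<^sub>0\<close>. These linear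
  equations express every coefficient as a multiple of \<open>f\<^sub>1\<close>, hence of \<open>a\<^sub>1\<close> since \<open>n\<^sub>1 \<noteq> 0\<close>, and
  the common factor \<open>a(t)\<close> of the conclusion is \<open>a\<^sub>1\<close>. The two groups of equations are
  \<open>accessible_at_zero_conditions\<close> and \<open>accessible_at_infinity_conditions\<close>.

  The scheme only asserts that some polynomials \<open>A, B, G, H\<close> represent the system in the local
  coordinates. They are the ones above because the coordinates are algebraically
  independent over \<open>C(t)\<close>, which is \<open>subst2_injective\<close>. Its proof is the Jacobian criterion in
  characteristic zero, applied to one variable at a time: if a derivation kills the coefficients
  but not \<open>x\<close>, then differentiating a polynomial relation for \<open>x\<close> produces a relation of smaller
  degree, so there is none (\<open>eval_injective\<close>).
\<close>

section \<open>Algebraic independence by means of derivations\<close>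

instance fract :: ("{idom, ring_char_0}") ring_char_0
proof
  have *: "of_nat n = to_fract (of_nat n :: 'a)" for n
    by (induction n) simp_all
  show "inj (of_nat :: nat \<Rightarrow> 'a fract)"
    by (rule injI) (simp add: *)
qed

instance fract :: ("{idom, ring_char_0}") field_char_0 ..

text \<open>
  Evaluating the coefficients of a polynomial by a homomorphism and the variable at a point is
  again such a homomorphism. A substitution into a polynomial in two variables is this
  construction performed twice.
\<close>

locale coefficient_hom =
  fixes h :: "'a::{idom,ring_char_0} \<Rightarrow> 'b::{idom,ring_char_0}"
  assumes hom_add: "h (p + q) = h p + h q"
    and hom_mult: "h (p * q) = h p * h q"
    and hom_one: "h 1 = 1"
begin

lemma hom_zero: "h 0 = 0"
  using hom_add[of 0 0] by simp

lemma eval_pCons: "poly (map_poly h (pCons c p)) x = h c + x * poly (map_poly h p) x"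
  by (simp add: map_poly_pCons hom_zero)

lemma coefficient_hom_eval: "coefficient_hom (\<lambda>p. poly (map_poly h p) x)"
proof
  show add: "poly (map_poly h (p + q)) x = poly (map_poly h p) x + poly (map_poly h q) x" for p q
  proof (induction p q rule: poly_induct2)
    case (pCons a p b q)
    then show ?case by (simp add: eval_pCons hom_add algebra_simps)
  qed simp
  have smult: "poly (map_poly h (smult c p)) x = h c * poly (map_poly h p) x" for c p
    by (induction p) (simp_all add: eval_pCons hom_mult algebra_simps hom_zero)
  show "poly (map_poly h (p * q)) x = poly (map_poly h p) x * poly (map_poly h q) x" for p q
    by (induction p) (simp_all add: eval_pCons add smult hom_zero algebra_simps)
  show "poly (map_poly h 1) x = 1"
    by (simp add: hom_one)
qed

lemma derivation_eval:
  assumes D: "derivation D" and const: "\<And>c. D (h c) = 0"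
  shows "D (poly (map_poly h p) x) = poly (map_poly h (pderiv p)) x * D x"
proof (induction p)
  case 0
  then show ?case by (simp add: derivation_zero[OF D])
next
  case (pCons c p)
  interpret ev: coefficient_hom "\<lambda>p. poly (map_poly h p) x"
    by (rule coefficient_hom_eval)
  have "D (h c + x * poly (map_poly h p) x) =
      D x * poly (map_poly h p) x + x * D (poly (map_poly h p) x)"
    using D const by (simp add: derivation_def)
  with pCons.IH show ?case
    by (simp add: eval_pCons pderiv_pCons ev.hom_add hom_zero algebra_simps)
qed

text \<open>
  If \<open>p(x) = 0\<close>, applying \<open>D\<close> gives \<open>p'(x) D x = 0\<close>, so \<open>p'(x) = 0\<close>. By induction on the degree
  \<open>p' = 0\<close>, and in characteristic zero \<open>p\<close> is a constant, which the injective \<open>h\<close> detects.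
\<close>

lemma eval_injective:
  assumes D: "derivation D" and const: "\<And>c. D (h c) = 0" and x: "D x \<noteq> 0"
    and inj: "inj h"
  shows "inj (\<lambda>p. poly (map_poly h p) x)"
proof -
  interpret ev: coefficient_hom "\<lambda>p. poly (map_poly h p) x"
    by (rule coefficient_hom_eval)
  have zero: "p = 0" if "poly (map_poly h p) x = 0" for p
    using that
  proof (induction "degree p" arbitrary: p rule: less_induct)
    case less
    have "poly (map_poly h (pderiv p)) x = 0"
      using derivation_eval[OF D const, of p x] x less.prems by (simp add: derivation_zero[OF D])
    with less.hyps[of "pderiv p"] have "pderiv p = 0"
      by (cases "degree p = 0") (simp_all add: degree_pderiv pderiv_eq_0_iff)
    then obtain c where "p = [:c:]" using pderiv_iszero by blast
    with less.prems have "h c = h 0" by (simp add: eval_pCons hom_zero)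
    with inj \<open>p = [:c:]\<close> show ?case by (simp add: inj_eq)
  qed
  show ?thesis
  proof (rule injI)
    fix p q assume "poly (map_poly h p) x = poly (map_poly h q) x"
    then have "poly (map_poly h (p - q)) x = 0"
      using ev.hom_add[of "p - q" q] by simp
    with zero show "p = q" by fastforce
  qed
qed

end

section \<open>Substitution and derivations in the field \<open>C(t)(u,v)\<close>\<close>

lemma rconst_hom: "coefficient_hom rconst"
  by standard (simp_all add: rconst_def bconst_def flip: to_fract_add to_fract_mult one_pCons)

lemma rconst_injective: "inj rconst"
  by (rule injI) (simp add: rconst_def bconst_def)

lemma subst2_hom: "coefficient_hom (\<lambda>p. subst2 p X Y)"
  unfolding subst2_def
  by (intro coefficient_hom.coefficient_hom_eval rconst_hom)

definition partial_u :: "birat \<Rightarrow> birat" where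
  "partial_u = fract_deriv (map_poly pderiv)"

definition partial_v :: "birat \<Rightarrow> birat" where
  "partial_v = fract_deriv pderiv"

lemma derivation_partial_u: "derivation partial_u" and derivation_partial_v: "derivation partial_v"
  unfolding partial_u_def partial_v_def
  by (intro derivation_fract_deriv derivation_map_poly derivation_pderiv)+

lemma fract_deriv_to_fract:
  assumes "derivation d" shows "fract_deriv d (to_fract p) = to_fract (d p)"
  using assms derivation_one[OF assms] unfolding to_fract_def
  by (subst fract_deriv_Fract) (auto simp: derivation_def)

lemma map_poly_pderiv_one: "map_poly pderiv (1 :: bipoly) = 0"
  by (rule derivation_one[OF derivation_map_poly[OF derivation_pderiv]])

lemma partial_u_simps:
  "partial_u (to_fract uvar) = 1" "partial_u (to_fract vvar) = 0" "partial_u (rconst c) = 0"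
  by (simp_all add: partial_u_def fract_deriv_to_fract derivation_map_poly derivation_pderiv uvar_def
     vvar_def rconst_def bconst_def map_poly_pCons pderiv_pCons map_poly_pderiv_one flip: one_pCons)

lemma partial_v_simps:
  "partial_v (to_fract uvar) = 0" "partial_v (to_fract vvar) = 1" "partial_v (rconst c) = 0"
  by (simp_all add: partial_v_def fract_deriv_to_fract derivation_pderiv uvar_def
     vvar_def rconst_def bconst_def pderiv_pCons flip: one_pCons)

text \<open>
  The Jacobian matrix of \<open>(X, Y)\<close> is triangular because \<open>X\<close> does not involve \<open>v\<close>. Therefore the
  one-variable criterion applies first to \<open>X\<close> over the constants, with \<open>\<partial>/\<partial>u\<close>, and then to \<open>Y\<close>
  over the polynomials in \<open>X\<close>, with \<open>\<partial>/\<partial>v\<close>, which kills them.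
\<close>

lemma subst2_injective:
  assumes "partial_u X \<noteq> 0" "partial_v X = 0" "partial_v Y \<noteq> 0"
  shows "inj (\<lambda>p. subst2 p X Y)"
proof -
  let ?h = "\<lambda>q. poly (map_poly rconst q) X"
  interpret h: coefficient_hom ?h
    by (intro coefficient_hom.coefficient_hom_eval rconst_hom)
  have "inj ?h"
    using derivation_partial_u partial_u_simps(3) assms(1) rconst_injective
    by (rule coefficient_hom.eval_injective[OF rconst_hom])
  moreover have "partial_v (?h q) = 0" for q
    using coefficient_hom.derivation_eval[OF rconst_hom derivation_partial_v partial_v_simps(3)] assms(2)
    by simp
  ultimately show ?thesis
    unfolding subst2_def using h.eval_injective[OF derivation_partial_v _ assms(3)] by blast
qed

lemma subst2_simps:
  "subst2 (p + q) X Y = subst2 p X Y + subst2 q X Y"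
  "subst2 (p - q) X Y = subst2 p X Y - subst2 q X Y"
  "subst2 (p * q) X Y = subst2 p X Y * subst2 q X Y"
  "subst2 (p ^ n) X Y = subst2 p X Y ^ n"
  "subst2 (bconst c) X Y = rconst c" "subst2 uvar X Y = X" "subst2 vvar X Y = Y"
proof -
  interpret coefficient_hom "\<lambda>p. subst2 p X Y" by (rule subst2_hom)
  interpret r: coefficient_hom rconst by (rule rconst_hom)
  show "subst2 (p + q) X Y = subst2 p X Y + subst2 q X Y" by (rule hom_add)
  show "subst2 (p - q) X Y = subst2 p X Y - subst2 q X Y"
    using hom_add[of "p - q" q] by (simp add: algebra_simps)
  show "subst2 (p * q) X Y = subst2 p X Y * subst2 q X Y" by (rule hom_mult)
  show "subst2 (p ^ n) X Y = subst2 p X Y ^ n"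
    by (induction n) (simp_all add: hom_one hom_mult)
  show "subst2 (bconst c) X Y = rconst c" "subst2 uvar X Y = X" "subst2 vvar X Y = Y"
    by (simp_all add: subst2_def bconst_def uvar_def vvar_def map_poly_pCons r.hom_zero r.hom_one)
qed


lemma rconst_simps:
  "rconst 0 = 0" "rconst 1 = 1" "rconst (p + q) = rconst p + rconst q"
  "rconst (p - q) = rconst p - rconst q" "rconst (- p) = - rconst p"
  "rconst (p * q) = rconst p * rconst q" "rconst (numeral n) = numeral n"
  "rconst (p / q) = rconst p / rconst q"
proof -
  interpret r: coefficient_hom rconst by (rule rconst_hom)
  show 0: "rconst 0 = 0" and 1: "rconst 1 = 1" by (fact r.hom_zero r.hom_one)+
  show "rconst (p + q) = rconst p + rconst q"  for p q by (fact r.hom_add)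
  show m: "rconst (p * q) = rconst p * rconst q" for p q by (fact r.hom_mult)
  show "rconst (p - q) = rconst p - rconst q" for p q
    using r.hom_add[of "p - q" q] by simp
  show "rconst (- p) = - rconst p" for p
    using r.hom_add[of "- p" p] by (simp add: 0 eq_neg_iff_add_eq_0)
  have "rconst (of_nat k) = of_nat k" for k
    by (induction k) (simp_all add: 0 1 r.hom_add)
  from this[of "numeral n"] show "rconst (numeral n) = numeral n" by simp
  have z: "rconst q = 0 \<longleftrightarrow> q = 0" for q
    using rconst_injective 0 by (metis injD)
  show "rconst (p / q) = rconst p / rconst q" for p q
    using m[of "p / q" q] z[of q] by (cases "q = 0") (simp_all add: 0 field_simps)
qed

lemma const_simps:
  "const 0 = 0" "const 1 = 1" "const (c + d) = const c + const d"
  "const (c - d) = const c - const d" "const (- c) = - const c"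
  "const (c * d) = const c * const d" "const (numeral n) = numeral n"
  "const (c / d) = const c / const d"
proof -
  show 0: "const 0 = 0" and 1: "const 1 = 1" by (simp_all add: const_def flip: one_pCons)
  show a: "const (c + d) = const c + const d" for c d
    by (simp add: const_def flip: to_fract_add)
  show m: "const (c * d) = const c * const d" for c d
    by (simp add: const_def flip: to_fract_mult)
  show "const (c - d) = const c - const d" "const (- c) = - const c" for c d
    by (simp_all add: const_def flip: to_fract_diff to_fract_uminus)
  have "const (of_nat k) = of_nat k" for k
    by (induction k) (simp_all add: 0 1 a)
  from this[of "numeral n"] show "const (numeral n) = numeral n" by simp
  have z: "const d = 0 \<longleftrightarrow> d = 0" for d by (simp add: const_def)
  show "const (c / d) = const c / const d" for c d
    using m[of "c / d" d] z[of d] by (cases "d = 0") (simp_all add: 0 field_simps)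
qed

lemma const_eq_0_iff: "const c = 0 \<longleftrightarrow> c = 0"
  by (simp add: const_def)

lemma to_fract_power: "to_fract (p ^ n) = to_fract p ^ n"
  by (induction n) simp_all

lemma to_fract_bconst: "to_fract (bconst c) = rconst c"
  by (simp add: rconst_def)

lemma uvar_vvar_nonzero: "to_fract uvar \<noteq> 0" "to_fract vvar \<noteq> 0"
  by (simp_all add: uvar_def vvar_def)

lemma derivation_power:
  fixes D :: "'a::comm_ring_1 \<Rightarrow> 'a"
  assumes "derivation D"
  shows "D (x ^ Suc n) = of_nat (Suc n) * x ^ n * D x"
  using assms by (induction n) (simp_all add: derivation_def algebra_simps)

lemma derivation_inverse:
  fixes D :: "'a::field \<Rightarrow> 'a"
  assumes D: "derivation D" and x: "x \<noteq> 0"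
  shows "D (1 / x) = - D x / x^2"
proof -
  have "D (x * (1 / x)) = D x * (1 / x) + x * D (1 / x)"
    using D unfolding derivation_def by blast
  moreover have "D (x * (1 / x)) = 0" using x by (simp add: derivation_one[OF D])
  ultimately have "x * D (1 / x) = - (D x / x)"
    by (simp add: eq_neg_iff_add_eq_0 add.commute)
  with x have "D (1 / x) = - (D x / x) / x" by (simp add: field_simps)
  then show ?thesis by (simp add: power2_eq_square)
qed

section \<open>Local forms of the system at the two accessible singular points\<close>

lemma multiplicity_3_at_zero_S:
  assumes "multiplicity_3_at_zero (S_x \<alpha>2 a) (S_y \<alpha>2 a)"
  shows "a 2 = 0" "a 5 = 0" "a 7 = 0" "a 9 = 0" "a 10 = 0"
proof -
  have X: "[:0, 1:] ^ n = monom (1::ratfun) n" for n by (simp add: monom_altdef)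
  have x: "coeff (S_x \<alpha>2 a) 1 = [:a 7, a 5, a 2, a 1:]"
    by (simp add: S_x_def Let_def uvar_def vvar_def bconst_def power2_eq_square power3_eq_cube)
  have y: "coeff (S_y \<alpha>2 a) 2 = [:a 10, a 9, a 3:]"
    by (simp add: S_y_def Let_def uvar_def vvar_def bconst_def power2_eq_square numeral_2_eq_2)
  have "coeff [:a 7, a 5, a 2, a 1:] k = 0" if "k < 3" for k
    using assms that unfolding multiplicity_3_at_zero_def x X monom_1_dvd_iff' by blast
  from this[of 0] this[of 1] this[of 2] show "a 2 = 0" "a 5 = 0" "a 7 = 0"
    by (simp_all add: numeral_2_eq_2)
  have "coeff [:a 10, a 9, a 3:] k = 0" if "k < 2" for k
    using assms that unfolding multiplicity_3_at_zero_def y X monom_1_dvd_iff' by blast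
  from this[of 0] this[of 1] show "a 9 = 0" "a 10 = 0"
    by simp_all
qed

lemma linear_approx_coeffs:
  assumes "linear_approx F1 F2 m11 m12 m21 m22"
  shows "bcoeff F1 1 0 = m11" "bcoeff F1 0 1 = m12" "bcoeff F2 1 0 = m21" "bcoeff F2 0 1 = m22"
proof -
  have "bcoeff (F - (bconst m * uvar + bconst n * vvar)) 1 0 = bcoeff F 1 0 - m"
    "bcoeff (F - (bconst m * uvar + bconst n * vvar)) 0 1 = bcoeff F 0 1 - n" for F m n
    by (simp_all add: bcoeff_def bconst_def uvar_def vvar_def)
  then show "bcoeff F1 1 0 = m11" "bcoeff F1 0 1 = m12" "bcoeff F2 1 0 = m21" "bcoeff F2 0 1 = m22"
    using assms unfolding linear_approx_def order_ge2_def
    by (metis add_0 add_0_right eq_iff_diff_eq_0 one_less_numeral_iff semiring_norm(76))+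
qed

lemma bcoeff_shift:
  "bcoeff (uvar * p) (Suc i) j = bcoeff p i j"
  "bcoeff (vvar * p) i (Suc j) = bcoeff p i j"
  by (simp_all add: bcoeff_def uvar_def vvar_def)

text \<open>
  The conditions are read off the explicit local form of the system, which is the only
  polynomial one. It comes from \<open>dW/dt = 3 x\<^sup>2 y dx/dt + x\<^sup>3 dy/dt\<close> after replacing \<open>x\<^sup>3 y\<close> by
  \<open>W - 1/2\<close>.
\<close>

lemma accessible_at_zero_conditions:
  fixes p31 p20 p10 p00 q22 q11 q01 q00 :: ratfun
  defines "P \<equiv> bconst p31 * uvar^3 * vvar + bconst p20 * uvar^2 + bconst p10 * uvar + bconst p00"
    and "Q \<equiv> bconst q22 * uvar^2 * vvar^2 + bconst q11 * uvar * vvar + bconst q01 * vvar + bconst q00"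
  assumes "accessible_at_zero P Q m11 m12 m21 m22"
  shows "3 * p31 + q22 = 6 * p00" "m11 = p00 - p31 / 2" "m21 = - (3 * p10 + q01) / 2"
proof -
  define x y where "x = to_fract uvar" and "y = to_fract vvar"
  define W where "W = x^3 * y + rconst (const (1/2))"
  note xy = uvar_vvar_nonzero[folded x_def y_def]
  note D = derivation_along[of P Q]
  from assms(3) obtain A B where A: "along P Q x = subst2 A x W"
    and B: "along P Q W = subst2 B x W / x" and B0: "bcoeff B 0 0 = 0"
    and lin: "linear_approx (uvar * A) B m11 m12 m21 m22"
    unfolding accessible_at_zero_def Let_def x_def y_def W_def by blast
  have "partial_v W = x^3"
    using derivation_partial_v derivation_power[OF derivation_partial_v, of x 2]
    by (simp add: W_def derivation_def partial_v_simps x_def y_def)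
  then have inj: "inj (\<lambda>p. subst2 p x W)"
    using xy by (intro subst2_injective) (simp_all add: x_def partial_u_simps partial_v_simps)
  define Z :: bipoly where "Z = vvar - bconst (1/2)"
  \<comment> \<open>\<open>A0\<close> and \<open>B0\<close> are the explicit local form, written in \<open>Z = W - 1/2\<close>.\<close>
  define A0 where "A0 = bconst p31 * Z + bconst p20 * uvar^2 + bconst p10 * uvar + bconst p00"
  define B0 where "B0 = bconst 3 * Z * A0 + bconst q22 * Z^2 + bconst q11 * Z * uvar^2
      + bconst q01 * Z * uvar + bconst q00 * uvar^4"
  have Z: "subst2 Z x W = x^3 * y"
    by (simp add: Z_def W_def subst2_simps rconst_simps const_simps)
  have Px: "along P Q x = rconst p31 * x^3 * y + rconst p20 * x^2 + rconst p10 * x + rconst p00"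
    by (simp add: x_def y_def along_uvar) (simp add: P_def to_fract_power to_fract_bconst)
  have Qy: "along P Q y = rconst q22 * x^2 * y^2 + rconst q11 * x * y + rconst q01 * y + rconst q00"
    by (simp add: x_def y_def along_vvar) (simp add: Q_def to_fract_power to_fract_bconst)
  have A_eq: "A = A0"
  proof (rule injD[OF inj])
    show "subst2 A x W = subst2 A0 x W"
      unfolding A[symmetric] A0_def Px by (simp add: subst2_simps Z)
  qed
  have "along P Q W = 3 * x^2 * along P Q x * y + x^3 * along P Q y"
    using D derivation_power[OF D, of x 2]
    by (simp add: W_def derivation_def along_rconst ddt_const rconst_simps)
  also have "\<dots> = subst2 B0 x W / x"
    using xy unfolding A A_eq Qy B0_def by (simp add: subst2_simps Z rconst_simps field_simps)
      (simp add: eval_nat_numeral algebra_simps)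
  finally have B_eq: "B = B0"
    using xy B by (intro injD[OF inj]) simp
  have c: "bcoeff A0 0 0 = p00 - p31 / 2"
    "bcoeff B0 0 0 = 3 * p31 / 4 - 3 * p00 / 2 + q22 / 4"
    "bcoeff B0 1 0 = - (3 * p10 + q01) / 2"
    by (simp_all add: A0_def B0_def Z_def bcoeff_def bconst_def uvar_def vvar_def
        eval_nat_numeral field_simps)
  show "m11 = p00 - p31 / 2" 
    using linear_approx_coeffs(1)[OF lin] bcoeff_shift(1)[of A 0 0] c(1) A_eq by simp
  show "3 * p31 + q22 = 6 * p00" using B0 c(2) B_eq by (simp add: field_simps)
  show "m21 = - (3 * p10 + q01) / 2" using linear_approx_coeffs(3)[OF lin] B_eq c(3) by simp
qed


text \<open>
  Put \<open>w = x y + \<alpha>\<^sub>2 = - X / Y\<close>. In \<open>dY/dt = Y\<^sup>2 ((2 x y + \<alpha>\<^sub>2) dx/dt + x\<^sup>2 dy/dt)\<close> the coefficient of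
  \<open>x\<^sup>2\<close> inside the bracket is a quadratic polynomial in \<open>w\<close>, and \<open>x\<^sup>2 Y\<^sup>2 = 1 / w\<^sup>2\<close>. The special
  coefficients \<open>c2\<close> and \<open>(a\<^sub>1 \<alpha>\<^sub>2 + a\<^sub>4) \<alpha>\<^sub>2 / 2\<close> of the system make this quadratic equal to
  \<open>(2 a\<^sub>1 + a\<^sub>3) w\<^sup>2\<close>, so the poles cancel and \<open>2 a\<^sub>1 + a\<^sub>3\<close> is the constant term of \<open>H\<close>.
\<close>

lemma accessible_at_infinity_conditions:
  fixes \<alpha>2 :: complex and a :: "nat \<Rightarrow> ratfun"
  defines "c2 \<equiv> ((3 * a 1 + 2 * a 3) * const \<alpha>2 - a 4) / 2"
  assumes a: "a 2 = 0" "a 5 = 0" "a 7 = 0" "a 9 = 0" "a 10 = 0"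
    and acc: "accessible_at_infinity \<alpha>2 (S_x \<alpha>2 a) (S_y \<alpha>2 a) m11 m12 m21 m22"
  shows "a 1 = m11" "a 1 * const \<alpha>2 - c2 = m12" "2 * a 1 + a 3 = m22"
proof -
  define P Q where "P = S_x \<alpha>2 a" and "Q = S_y \<alpha>2 a"
  define x y where "x = to_fract uvar" and "y = to_fract vvar"
  define al where "al = rconst (const \<alpha>2)"
  define w where "w = x * y + al"
  define X Y where "X = 1 / x" and "Y = 1 / (- w * x)"
  note xy = uvar_vvar_nonzero[folded x_def y_def]
  note D = derivation_along[of P Q]
  from acc obtain G H where G: "along P Q X = subst2 G X Y / Y"
    and H: "along P Q Y = subst2 H X Y"
    and lin: "linear_approx G (vvar * H) m11 m12 m21 m22"
    unfolding accessible_at_infinity_def Let_def x_def y_def w_def X_def Y_def P_def Q_def al_def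
    by blast
  have "w = to_fract (uvar * vvar + bconst (const \<alpha>2))"
    by (simp add: w_def al_def x_def y_def to_fract_bconst)
  moreover have "uvar * vvar + bconst (const \<alpha>2) \<noteq> 0"
    by (simp add: uvar_def vvar_def bconst_def)
  ultimately have w: "w \<noteq> 0" by (metis to_fract_eq_0_iff)
  have wx: "- w * x \<noteq> 0" using w xy by simp
  \<comment> \<open>The same quotient rules serve the time derivative and the two partial derivatives, since all
    three kill \<open>\<alpha>\<^sub>2\<close>.\<close>
  have dX: "E X = - E x / x^2" and dY: "E Y = ((E x * y + x * E y) * x + w * E x) / (w * x)^2"
    if E: "derivation E" "E al = 0" for E
  proof -
    show "E X = - E x / x^2"
      unfolding X_def using xy by (intro derivation_inverse E)
    have sum: "E (p + q) = E p + E q" and prod: "E (p * q) = E p * q + p * E q" for p q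
      using E(1) unfolding derivation_def by blast+
    have "E (- w * x) + E (w * x) = 0"
      using derivation_zero[OF E(1)] by (simp flip: sum)
    then have "- E (- w * x) = E (w * x)"
      by (simp add: neg_eq_iff_add_eq_0)
    also have "\<dots> = (E x * y + x * E y) * x + w * E x"
      using E(2) by (simp add: prod) (simp add: w_def sum prod)
    finally show "E Y = ((E x * y + x * E y) * x + w * E x) / (w * x)^2"
      unfolding Y_def using derivation_inverse[OF E(1) wx] by simp
  qed
  note du = derivation_partial_u partial_u_simps(3)[of "const \<alpha>2", folded al_def]
  note dv = derivation_partial_v partial_v_simps(3)[of "const \<alpha>2", folded al_def]
  have inj: "inj (\<lambda>p. subst2 p X Y)"
    using xy w unfolding x_def y_def
    by (intro subst2_injective)
       (simp_all add: dX[OF du] dX[OF dv] dY[OF dv] partial_u_simps partial_v_simps x_def y_def)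
  have Dal: "along P Q al = 0"
    by (simp add: al_def along_rconst ddt_const rconst_simps)
  define G0 where "G0 = bconst (a 1) * uvar + bconst (a 1 * const \<alpha>2 - c2) * vvar
      + bconst (a 6) * uvar * vvar - bconst (a 8) * uvar^2 * vvar"
  define H0 where "H0 = bconst (2 * a 1 + a 3) + bconst (a 6) * vvar
      - bconst (2 * a 8) * uvar * vvar - bconst (a 8 * const \<alpha>2) * vvar^2"
  \<comment> \<open>Eliminating \<open>y\<close> in favour of \<open>w\<close> makes \<open>X\<close> and \<open>Y\<close> monomials, up to sign, in \<open>x\<close> and \<open>w\<close>.\<close>
  have y_eq: "y = (w - al) / x" using xy by (simp add: w_def)
  have Px: "along P Q x = rconst (a 1) * x^3 * y + rconst c2 * x^2 - rconst (a 6) * x + rconst (a 8)"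
    by (simp add: x_def y_def along_uvar)
      (simp add: P_def S_x_def Let_def a to_fract_power to_fract_bconst rconst_simps const_simps c2_def)
  have Qy: "along P Q y = rconst (a 3) * x^2 * y^2 + rconst (a 4) * x * y + rconst (a 6) * y
      + (rconst (a 1) * al + rconst (a 4)) * al / 2"
    by (simp add: x_def y_def along_vvar)
      (simp add: Q_def S_y_def Let_def a to_fract_power to_fract_bconst rconst_simps const_simps al_def)
  have "along P Q X * Y = subst2 G0 X Y"
    unfolding dX[OF D Dal] Px G0_def using w xy
    by (simp add: subst2_simps X_def Y_def rconst_simps y_eq field_simps al_def[symmetric])
      (simp add: eval_nat_numeral algebra_simps)
  then have G_eq: "G = G0"
    using G w xy by (intro injD[OF inj]) (simp add: Y_def)
  have "along P Q Y = subst2 H0 X Y"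
    unfolding dY[OF D Dal] Px Qy H0_def using w xy
    by (simp add: subst2_simps X_def Y_def rconst_simps y_eq field_simps al_def[symmetric] c2_def)
      (simp add: eval_nat_numeral algebra_simps)
  then have H_eq: "H = H0"
    using H by (intro injD[OF inj]) simp
  have c: "bcoeff G0 1 0 = a 1" "bcoeff G0 0 1 = a 1 * const \<alpha>2 - c2" "bcoeff H0 0 0 = 2 * a 1 + a 3"
    by (simp_all add: G0_def H0_def bcoeff_def bconst_def uvar_def vvar_def eval_nat_numeral)
  show "a 1 = m11" "a 1 * const \<alpha>2 - c2 = m12" "2 * a 1 + a 3 = m22"
    using linear_approx_coeffs(1,2,4)[OF lin] bcoeff_shift(2)[of H 0 0] c G_eq H_eq by simp_all
qed

section \<open>Determination of the system by its scheme\<close>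

lemma bconst_simps:
  "bconst (p + q) = bconst p + bconst q" "bconst (- p) = - bconst p"
  "bconst (p * q) = bconst p * bconst q"
  by (simp_all add: bconst_def)

theorem theorem6p1:
  fixes n1 n2 \<alpha>1 \<alpha>2 :: complex
    and a :: "nat \<Rightarrow> ratfun"
  assumes "n1 \<noteq> 0"
    and "\<exists>f0 f1. painleve_scheme n1 n2 \<alpha>1 \<alpha>2 (S_x \<alpha>2 a) (S_y \<alpha>2 a) f0 f1"
  shows "\<exists>b :: ratfun. let x = uvar; y = vvar; k = (\<lambda>c. bconst (const c)); t = bconst tvar in
     S_x \<alpha>2 a = bconst b *
       (x^3 * y + k ((n1 * \<alpha>2 - \<alpha>1) / n1) * x^2
        + k ((2 * n1 - 1) / (3 * n1)) * t * x + k ((n1 + 1) / (6 * n1))) \<and>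
     S_y \<alpha>2 a = bconst b *
       (- k ((2 * n1 - 1) / n1) * x^2 * y^2
        + k ((2 * \<alpha>1 - (3 * n1 - 2) * \<alpha>2) / n1) * x * y
        - k ((2 * n1 - 1) / (3 * n1)) * t * y
        + k (\<alpha>2 * (\<alpha>1 - (n1 - 1) * \<alpha>2) / n1))"
proof -
  from assms(2) obtain f0 f1 where
    mult: "multiplicity_3_at_zero (S_x \<alpha>2 a) (S_y \<alpha>2 a)" and
    zero: "accessible_at_zero (S_x \<alpha>2 a) (S_y \<alpha>2 a)
      (f0 * 1) (f0 * 0) (f0 * (2 * tvar)) (f0 * const n2)" and
    infinity: "accessible_at_infinity \<alpha>2 (S_x \<alpha>2 a) (S_y \<alpha>2 a)
      (f1 * const n1) (f1 * const \<alpha>1) (f1 * 0) (f1 * 1)"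
    unfolding painleve_scheme_def by blast
  \<comment> \<open>The equations of both points are solved in terms of \<open>f1\<close> and \<open>N = n1\<close>.\<close>
  note a = multiplicity_3_at_zero_S[OF mult]
  note [simp] = const_simps
  define N where "N = const n1"
  have N: "N \<noteq> 0" using assms(1) by (simp add: N_def const_eq_0_iff)
  define c2 where "c2 = ((3 * a 1 + 2 * a 3) * const \<alpha>2 - a 4) / 2"
  define q0 where "q0 = (a 1 * const \<alpha>2 + a 4) * const \<alpha>2 / 2"
  have Sx: "S_x \<alpha>2 a = bconst (a 1) * uvar^3 * vvar + bconst c2 * uvar^2 + bconst (- a 6) * uvar
      + bconst (a 8)"
    by (simp add: S_x_def Let_def a c2_def) (simp add: bconst_def)
  have Sy: "S_y \<alpha>2 a = bconst (a 3) * uvar^2 * vvar^2 + bconst (a 4) * uvar * vvar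
      + bconst (a 6) * vvar + bconst q0"
    by (simp add: S_y_def Let_def a q0_def) (simp add: bconst_def)
  note z = accessible_at_zero_conditions[OF zero[unfolded Sx Sy]]
  note i = accessible_at_infinity_conditions[OF a infinity, folded c2_def N_def]
  have a1: "a 1 = f1 * N" and a3: "a 3 = f1 * (1 - 2 * N)"
    using i(1,3) by (simp_all add: algebra_simps)
  have a8: "a 8 = f1 * (N + 1) / 6"
    using z(1) unfolding a1 a3 by (simp add: field_simps)
  have "f0 = a 8 - a 1 / 2"
    using z(2) by simp
  also have "\<dots> = f1 * (1 - 2 * N) / 6"
    unfolding a1 a8 by (simp add: field_simps)
  finally have f0: "f0 = f1 * (1 - 2 * N) / 6" .
  have a6: "a 6 = f1 * (1 - 2 * N) * tvar / 3"
  proof -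
    have "- (3 * - a 6 + a 6) / 2 = a 6" by (simp add: field_simps)
    with z(3) have "a 6 = f0 * (2 * tvar)" by simp
    show ?thesis unfolding \<open>a 6 = f0 * (2 * tvar)\<close> f0 by (simp add: field_simps)
  qed
  have c2: "c2 = f1 * (N * const \<alpha>2 - const \<alpha>1)"
    using i(2) unfolding a1 by (simp add: algebra_simps)
  have a4: "a 4 = f1 * (2 * const \<alpha>1 - (3 * N - 2) * const \<alpha>2)"
    using c2 unfolding c2_def a1 a3 by (simp add: field_simps)
  have q0: "q0 = f1 * (const \<alpha>2 * (const \<alpha>1 - (N - 1) * const \<alpha>2))"
    unfolding q0_def a1 a4 by (simp add: field_simps)
  have "c2 = a 1 * const ((n1 * \<alpha>2 - \<alpha>1) / n1)"
    "- a 6 = a 1 * (const ((2 * n1 - 1) / (3 * n1)) * tvar)"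
    "a 8 = a 1 * const ((n1 + 1) / (6 * n1))"
    using N unfolding a1 a6 a8 c2 by (simp_all add: field_simps flip: N_def)
  note x = this
  have "a 3 = a 1 * - const ((2 * n1 - 1) / n1)"
    "a 4 = a 1 * const ((2 * \<alpha>1 - (3 * n1 - 2) * \<alpha>2) / n1)"
    "a 6 = a 1 * - (const ((2 * n1 - 1) / (3 * n1)) * tvar)"
    "q0 = a 1 * const (\<alpha>2 * (\<alpha>1 - (n1 - 1) * \<alpha>2) / n1)"
    using N unfolding a1 a3 a4 a6 q0 by (simp_all add: field_simps flip: N_def)
  note y = this
  show ?thesis
    unfolding Let_def
  proof (intro exI[of _ "a 1"] conjI)
    show "S_x \<alpha>2 a = bconst (a 1) *
       (uvar^3 * vvar + bconst (const ((n1 * \<alpha>2 - \<alpha>1) / n1)) * uvar^2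
        + bconst (const ((2 * n1 - 1) / (3 * n1))) * bconst tvar * uvar
        + bconst (const ((n1 + 1) / (6 * n1))))"
      unfolding Sx x bconst_simps by (simp only: algebra_simps)
    show "S_y \<alpha>2 a = bconst (a 1) *
       (- bconst (const ((2 * n1 - 1) / n1)) * uvar^2 * vvar^2
        + bconst (const ((2 * \<alpha>1 - (3 * n1 - 2) * \<alpha>2) / n1)) * uvar * vvar
        - bconst (const ((2 * n1 - 1) / (3 * n1))) * bconst tvar * vvar
        + bconst (const (\<alpha>2 * (\<alpha>1 - (n1 - 1) * \<alpha>2) / n1)))"
      unfolding Sy y bconst_simps by (simp add: algebra_simps)
  qed
qed

end
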